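(* Let $G = F_{n_k} \rtimes F_{n_{k-1}} \rtimes \cdots \rtimes F_{n_1}$ be an almost-direct product of free groups, with a Magnus-type ordering with positive cone $\mathcal{P}(F_{n_i})$ fixed on each free factor $F_{n_i}$. Let $P \subset G$ be the set of all $g$ with normal form $g = g_k\cdots g_1$ ($g_i \in F_{n_i}$) for which there is $j \in \{1,\dots,k\}$ with $g_j \in \mathcal{P}(F_{n_j})$ and $g_i = 1$ for all $i > j$, and let $<$ be the lexicographic ordering on $G$ given by $g<h \iff g^{-1}h\in P$. For each $1\le j\le k$ let $\pi_j\colon G \to F_{n_j}$ be the map $\pi_j(g_k\cdots g_1) = g_j$. Let $g \in G$ be written in normal form as $g = g_k\cdots g_1$. If $g \in P$ and $j$ is the largest index such that $g_j \neq 1$, then $\pi_j(g) = g_j \in \mathcal{P}(F_{n_j})$. In particular, the ordering $<$ on $G$ restricts to the given Magnus-type ordering on each free factor $F_{n_j}$.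
   Context: Almost-direct products. Let $F_{n_1},\dots,F_{n_k}$ be free groups of finite ranks $n_1,\dots,n_k$. The iterated semidirect product $G = F_{n_k} \rtimes \cdots \rtimes F_{n_1}$ is read as follows: $G_1 = F_{n_1}$, $G_i = F_{n_i} \rtimes G_{i-1}$ for $i \ge 2$ (so $F_{n_i}$ is normal in $G_i$ and $G_{i-1}$ acts on $F_{n_i}$), and $G = G_k$. It is an almost-direct product of free groups if for each $i\ge 2$ the action of $G_{i-1}$ on $F_{n_i}$ induces the trivial action on the abelianization $F_{n_i}/[F_{n_i},F_{n_i}]$. Every $g \in G$ can be written uniquely as $g = g_k g_{k-1}\cdots g_1$ with $g_i \in F_{n_i}$; this is the normal form of $g$. Magnus-type ordering on the free group $F_n$: fix a free basis $x_1,\dots,x_n$ and let $\mu\colon F_n \to \mathbb{Z}\langle\langle X_1,\dots,X_n\rangle\rangle$ be the Magnus embedding into the ring of formal power series in noncommuting variables, $\mu(x_i) = 1 + X_i$. Order monomials first by degree and then lexicographically within each degree. An element $g \ne 1$ belongs to the positive cone $\mathcal{P}(F_n)$ iff the coefficient of the smallest monomial occurring with nonzero coefficient in $\mu(g) - 1$ is positive. The ordering on $F_n$ is $g<h \iff g^{-1}h\in\mathcal{P}(F_n)$. *)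

theory Defs
  imports "HOL-Algebra.Generated_Groups" "HOL-Algebra.Ring"
begin

section \<open>Free groups\<close>

text \<open>
  A group word is a list of letters \<open>(i, e)\<close>; the letter \<open>(i, True)\<close> stands for \<open>x\<^sub>i\<close>
  and \<open>(i, False)\<close> for its inverse.
\<close>

definition reduced_words :: "nat \<Rightarrow> (nat \<times> bool) list set" where
  "reduced_words n =
     {w. fst ` set w \<subseteq> {1..n} \<and> successively (\<lambda>(i, d) (j, e). \<not> (i = j \<and> d \<noteq> e)) w}"

primrec word_value :: "('a, 'b) monoid_scheme \<Rightarrow> (nat \<Rightarrow> 'a) \<Rightarrow> (nat \<times> bool) list \<Rightarrow> 'a" where
  "word_value M x [] = \<one>\<^bsub>M\<^esub>"
| "word_value M x (l # w) =
     (if snd l then x (fst l) else inv\<^bsub>M\<^esub> x (fst l)) \<otimes>\<^bsub>M\<^esub> word_value M x w"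

definition free_basis :: "('a, 'b) monoid_scheme \<Rightarrow> nat \<Rightarrow> (nat \<Rightarrow> 'a) \<Rightarrow> bool" where
  "free_basis M n x \<longleftrightarrow> group M \<and> x \<in> {1..n} \<rightarrow> carrier M \<and>
     bij_betw (word_value M x) (reduced_words n) (carrier M)"

definition reduced_word_of ::
    "('a, 'b) monoid_scheme \<Rightarrow> nat \<Rightarrow> (nat \<Rightarrow> 'a) \<Rightarrow> 'a \<Rightarrow> (nat \<times> bool) list" where
  "reduced_word_of M n x = inv_into (reduced_words n) (word_value M x)"

lemma (in group) word_value_closed:
  assumes "x \<in> {1..n} \<rightarrow> carrier G" "fst ` set w \<subseteq> {1..n}"
  shows "word_value G x w \<in> carrier G"
  using assms by (induction w) (auto simp: Pi_def)

lemma (in group) word_value_append: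
  assumes "x \<in> {1..n} \<rightarrow> carrier G" "fst ` set u \<subseteq> {1..n}" "fst ` set v \<subseteq> {1..n}"
  shows "word_value G x (u @ v) = word_value G x u \<otimes> word_value G x v"
  using assms
proof (induction u)
  case Nil
  then show ?case using word_value_closed[of x n v] by simp
next
  case (Cons l u)
  have l: "x (fst l) \<in> carrier G" using Cons.prems by (auto simp: Pi_def)
  have u: "word_value G x u \<in> carrier G" using Cons.prems word_value_closed[of x n u] by auto
  have v: "word_value G x v \<in> carrier G" using Cons.prems word_value_closed[of x n v] by auto
  show ?case using Cons l u v by (auto simp: m_assoc)
qed

fun reduce_cons :: "nat \<times> bool \<Rightarrow> (nat \<times> bool) list \<Rightarrow> (nat \<times> bool) list" where
  "reduce_cons l [] = [l]"
| "reduce_cons l (m # w) = (if fst l = fst m \<and> snd l \<noteq> snd m then w else l # m # w)"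

definition reduce :: "(nat \<times> bool) list \<Rightarrow> (nat \<times> bool) list" where
  "reduce w = foldr reduce_cons w []"

lemma reduce_cons_reduced:
  assumes "fst l \<in> {1..n}" "w \<in> reduced_words n"
  shows "reduce_cons l w \<in> reduced_words n"
  using assms by (cases w) (auto simp: reduced_words_def successively_Cons split: prod.splits)

lemma reduce_reduced:
  assumes "fst ` set w \<subseteq> {1..n}"
  shows "reduce w \<in> reduced_words n"
  using assms
proof (induction w)
  case Nil
  then show ?case by (simp add: reduce_def reduced_words_def)
next
  case (Cons l w)
  then show ?case using reduce_cons_reduced[of l n "reduce w"] by (simp add: reduce_def)
qed

lemma (in group) word_value_reduce_cons:
  assumes x: "x \<in> {1..n} \<rightarrow> carrier G" and l: "fst l \<in> {1..n}" and w: "fst ` set w \<subseteq> {1..n}"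
  shows "word_value G x (reduce_cons l w) = word_value G x (l # w)"
proof (cases w)
  case (Cons m v)
  have c: "x (fst l) \<in> carrier G" "x (fst m) \<in> carrier G" "word_value G x v \<in> carrier G"
    using x l w Cons word_value_closed[of x n v] by (auto simp: Pi_def)
  show ?thesis using c Cons by (auto simp: m_assoc[symmetric])
qed simp

lemma (in group) word_value_reduce:
  assumes x: "x \<in> {1..n} \<rightarrow> carrier G" and w: "fst ` set w \<subseteq> {1..n}"
  shows "word_value G x (reduce w) = word_value G x w"
  using w
proof (induction w)
  case (Cons l w)
  have "fst ` set (reduce w) \<subseteq> {1..n}"
    using reduce_reduced[of w n] Cons.prems by (auto simp: reduced_words_def)
  then show ?case
    using word_value_reduce_cons[OF x, of l "reduce w"] Cons by (simp add: reduce_def)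
qed (simp add: reduce_def)

lemma reduced_word_of_props:
  assumes "free_basis M n x" "a \<in> carrier M"
  shows "reduced_word_of M n x a \<in> reduced_words n"
    and "word_value M x (reduced_word_of M n x a) = a"
  using assms unfolding free_basis_def reduced_word_of_def bij_betw_def
  by (auto intro: inv_into_into f_inv_into_f)

lemma reduced_word_of_value:
  assumes "free_basis M n x" "w \<in> reduced_words n"
  shows "reduced_word_of M n x (word_value M x w) = w"
  using assms unfolding free_basis_def reduced_word_of_def bij_betw_def by auto

theorem free_basis_lift:
  assumes fb: "free_basis M n x" and H: "group H" and f: "f \<in> {1..n} \<rightarrow> carrier H"
  shows "(\<lambda>a. word_value H f (reduced_word_of M n x a)) \<in> hom M H"
    and "\<And>i. i \<in> {1..n} \<Longrightarrow> word_value H f (reduced_word_of M n x (x i)) = f i"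
proof -
  interpret M: group M using fb by (simp add: free_basis_def)
  interpret H: group H by (rule H)
  have x: "x \<in> {1..n} \<rightarrow> carrier M" using fb by (simp add: free_basis_def)
  let ?r = "reduced_word_of M n x"
  have letters: "fst ` set (?r a) \<subseteq> {1..n}" if "a \<in> carrier M" for a
    using reduced_word_of_props(1)[OF fb that] by (auto simp: reduced_words_def)
  show "(\<lambda>a. word_value H f (?r a)) \<in> hom M H"
  proof (rule homI)
    fix a assume "a \<in> carrier M"
    then show "word_value H f (?r a) \<in> carrier H"
      using H.word_value_closed[OF f letters] by blast
  next
    fix a b assume ab: "a \<in> carrier M" "b \<in> carrier M"
    let ?w = "?r a @ ?r b"
    have w: "fst ` set ?w \<subseteq> {1..n}" using letters ab by auto
    have "word_value M x (reduce ?w) = a \<otimes>\<^bsub>M\<^esub> b"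
      using M.word_value_reduce[OF x w] M.word_value_append[OF x letters letters] ab
        reduced_word_of_props(2)[OF fb] by simp
    then have "?r (a \<otimes>\<^bsub>M\<^esub> b) = reduce ?w"
      using reduced_word_of_value[OF fb reduce_reduced[OF w]] by simp
    then show "word_value H f (?r (a \<otimes>\<^bsub>M\<^esub> b)) = word_value H f (?r a) \<otimes>\<^bsub>H\<^esub> word_value H f (?r b)"
      using H.word_value_reduce[OF f w] H.word_value_append[OF f letters letters] ab by simp
  qed
  fix i assume i: "i \<in> {1..n}"
  have w: "[(i, True)] \<in> reduced_words n" using i by (simp add: reduced_words_def)
  have xi: "x i \<in> carrier M" "f i \<in> carrier H" using x f i by auto
  show "word_value H f (?r (x i)) = f i"
    using reduced_word_of_value[OF fb w] xi by simp
qed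


section \<open>Noncommutative formal power series over the integers\<close>

text \<open>
  The list \<open>[i\<^sub>1, \<dots>, i\<^sub>d]\<close> is the monomial \<open>X\<^bsub>i\<^sub>1\<^esub> \<cdots> X\<^bsub>i\<^sub>d\<^esub>\<close>, and a series is its function of
  coefficients.
\<close>

definition nc_power_series :: "nat \<Rightarrow> (nat list \<Rightarrow> int) ring" where
  "nc_power_series n =
     \<lparr> carrier = {f. \<forall>w. \<not> set w \<subseteq> {1..n} \<longrightarrow> f w = 0},
       mult = (\<lambda>f g w. \<Sum>k\<le>length w. f (take k w) * g (drop k w)),
       one = (\<lambda>w. if w = [] then 1 else 0),
       zero = (\<lambda>w. 0),
       add = (\<lambda>f g w. f w + g w) \<rparr>"

definition nc_var :: "nat \<Rightarrow> nat list \<Rightarrow> int" where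
  "nc_var i w = (if w = [i] then 1 else 0)"

lemma nc_mult_assoc:
  fixes f g h :: "nat list \<Rightarrow> int"
  shows "(\<Sum>k\<le>length w. (\<Sum>j\<le>length (take k w). f (take j (take k w)) * g (drop j (take k w)))
            * h (drop k w)) =
         (\<Sum>j\<le>length w. f (take j w) *
            (\<Sum>m\<le>length (drop j w). g (take m (drop j w)) * h (drop m (drop j w))))"
proof -
  let ?L = "length w"
  have "(\<Sum>k\<le>?L. (\<Sum>j\<le>length (take k w). f (take j (take k w)) * g (drop j (take k w)))
            * h (drop k w)) =
        (\<Sum>(k, j)\<in>(SIGMA k:{..?L}. {..k}). f (take j w) * g (drop j (take k w)) * h (drop k w))"
    by (subst sum.Sigma[symmetric])
       (auto simp: sum_distrib_right min_def intro!: sum.cong)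
  also have "\<dots> = (\<Sum>(j, m)\<in>(SIGMA j:{..?L}. {..?L - j}).
        f (take j w) * g (take m (drop j w)) * h (drop m (drop j w)))"
    by (rule sum.reindex_bij_witness[of _ "\<lambda>(j, m). (j + m, j)" "\<lambda>(k, j). (j, k - j)"])
       (auto simp: drop_take add.commute)
  also have "\<dots> = (\<Sum>j\<le>?L. f (take j w) *
            (\<Sum>m\<le>length (drop j w). g (take m (drop j w)) * h (drop m (drop j w))))"
    by (subst sum.Sigma[symmetric])
       (auto simp: sum_distrib_left mult.assoc intro!: sum.cong)
  finally show ?thesis .
qed

lemma nc_mult_support:
  fixes f g :: "nat list \<Rightarrow> int"
  assumes "\<forall>w. \<not> set w \<subseteq> A \<longrightarrow> f w = 0" "\<forall>w. \<not> set w \<subseteq> A \<longrightarrow> g w = 0" "\<not> set w \<subseteq> A"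
  shows "(\<Sum>k\<le>length w. f (take k w) * g (drop k w)) = 0"
proof (rule sum.neutral, intro ballI)
  fix k
  have "set (take k w) \<union> set (drop k w) = set w" by (metis append_take_drop_id set_append)
  then have "\<not> set (take k w) \<subseteq> A \<or> \<not> set (drop k w) \<subseteq> A" using assms(3) by blast
  then show "f (take k w) * g (drop k w) = 0" using assms by auto
qed

lemma nc_mult_one:
  fixes f :: "nat list \<Rightarrow> int"
  shows "(\<Sum>k\<le>length w. (if take k w = [] then 1 else 0) * f (drop k w)) = f w"
    and "(\<Sum>k\<le>length w. f (take k w) * (if drop k w = [] then 1 else 0)) = f w"
proof -
  have "(\<Sum>k\<le>length w. (if take k w = [] then 1 else 0) * f (drop k w)) =
      (\<Sum>k\<le>length w. if k = 0 then f w else 0)"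
    by (rule sum.cong) auto
  then show "(\<Sum>k\<le>length w. (if take k w = [] then 1 else 0) * f (drop k w)) = f w" by simp
  have "(\<Sum>k\<le>length w. f (take k w) * (if drop k w = [] then 1 else 0)) =
      (\<Sum>k\<le>length w. if k = length w then f w else 0)"
    by (rule sum.cong) auto
  then show "(\<Sum>k\<le>length w. f (take k w) * (if drop k w = [] then 1 else 0)) = f w" by simp
qed

lemma ring_nc_power_series: "ring (nc_power_series n)"
proof (rule ringI)
  show "abelian_group (nc_power_series n)"
  proof (rule abelian_groupI)
    fix f assume "f \<in> carrier (nc_power_series n)"
    then show "\<exists>g\<in>carrier (nc_power_series n). g \<oplus>\<^bsub>nc_power_series n\<^esub> f = \<zero>\<^bsub>nc_power_series n\<^esub>"
      by (intro bexI[of _ "\<lambda>w. - f w"]) (auto simp: nc_power_series_def)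
  qed (auto simp: nc_power_series_def algebra_simps)
  show "monoid (nc_power_series n)"
  proof (rule monoidI)
    fix f g assume "f \<in> carrier (nc_power_series n)" "g \<in> carrier (nc_power_series n)"
    then show "f \<otimes>\<^bsub>nc_power_series n\<^esub> g \<in> carrier (nc_power_series n)"
      unfolding nc_power_series_def using nc_mult_support[of "{1..n}" f g] by simp
  qed (simp_all only: nc_power_series_def monoid.simps ring.simps nc_mult_assoc nc_mult_one,
       auto simp: nc_power_series_def)
qed (auto simp: nc_power_series_def sum.distrib algebra_simps)

lemma one_plus_nc_var_unit:
  assumes i: "i \<in> {1..n}"
  shows "\<one>\<^bsub>nc_power_series n\<^esub> \<oplus>\<^bsub>nc_power_series n\<^esub> nc_var i \<in> Units (nc_power_series n)"
proof -
  define u :: "nat list \<Rightarrow> int" where "u = (\<lambda>w. (if w = [] then 1 else 0) + nc_var i w)"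
  define v :: "nat list \<Rightarrow> int"
    where "v = (\<lambda>w. if set w \<subseteq> {i} then (- 1) ^ length w else 0)"
  have uv: "(\<Sum>k\<le>length w. u (take k w) * v (drop k w)) = (if w = [] then 1 else 0)" for w
  proof (cases w)
    case Nil then show ?thesis by (simp add: u_def v_def nc_var_def)
  next
    case (Cons a w')
    have "(\<Sum>k\<le>length w. u (take k w) * v (drop k w)) =
      (\<Sum>k\<le>length w. (if k = 0 then v w else 0) + (if k = 1 then (if a = i then v w' else 0) else 0))"
      using Cons by (intro sum.cong) (auto simp: u_def nc_var_def take_Cons split: nat.splits)
    also have "\<dots> = v w + (if a = i then v w' else 0)"
      using Cons by (simp add: sum.distrib del: sum.atMost_Suc)
    also have "\<dots> = 0" using Cons by (auto simp: v_def)
    finally show ?thesis using Cons by simp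
  qed
  have vu: "(\<Sum>k\<le>length w. v (take k w) * u (drop k w)) = (if w = [] then 1 else 0)" for w
  proof (cases w rule: rev_cases)
    case Nil then show ?thesis by (simp add: u_def v_def nc_var_def)
  next
    case (snoc w' a)
    have "(\<Sum>k\<le>length w. v (take k w) * u (drop k w)) =
      (\<Sum>k\<le>length w. (if k = length w then v w else 0) +
         (if k = length w' then (if a = i then v w' else 0) else 0))"
    proof (rule sum.cong)
      fix k assume "k \<in> {..length w}"
      then consider "k = length w" | "k = length w'" | "k < length w'"
        using snoc by fastforce
      then show "v (take k w) * u (drop k w) = (if k = length w then v w else 0) +
         (if k = length w' then (if a = i then v w' else 0) else 0)"
      proof cases
        case 3
        then have "drop k w \<noteq> []" "drop k w \<noteq> [i]" using snoc by (auto simp: append_eq_Cons_conv)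
        then show ?thesis using 3 snoc by (auto simp: u_def nc_var_def)
      qed (use snoc in \<open>auto simp: u_def nc_var_def\<close>)
    qed simp
    also have "\<dots> = v w + (if a = i then v w' else 0)"
      using snoc by (simp add: sum.distrib del: sum.atMost_Suc)
    also have "\<dots> = 0" using snoc by (auto simp: v_def)
    finally show ?thesis using snoc by simp
  qed
  have "u \<in> carrier (nc_power_series n)" "v \<in> carrier (nc_power_series n)"
    using i by (auto simp: nc_power_series_def u_def v_def nc_var_def)
  moreover have "u \<otimes>\<^bsub>nc_power_series n\<^esub> v = \<one>\<^bsub>nc_power_series n\<^esub>"
      "v \<otimes>\<^bsub>nc_power_series n\<^esub> u = \<one>\<^bsub>nc_power_series n\<^esub>"
    by (auto simp: nc_power_series_def uv vu)
  ultimately have "u \<in> Units (nc_power_series n)" unfolding Units_def by blast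
  then show ?thesis by (simp add: u_def nc_power_series_def)
qed


section \<open>The Magnus ordering\<close>

definition magnus :: "('a, 'b) monoid_scheme \<Rightarrow> nat \<Rightarrow> (nat \<Rightarrow> 'a) \<Rightarrow> 'a \<Rightarrow> nat list \<Rightarrow> int" where
  "magnus M n x a =
     word_value (units_of (nc_power_series n))
       (\<lambda>i. \<one>\<^bsub>nc_power_series n\<^esub> \<oplus>\<^bsub>nc_power_series n\<^esub> nc_var i) (reduced_word_of M n x a)"

theorem magnus_hom:
  assumes "free_basis M n x"
  shows "magnus M n x \<in> hom M (units_of (nc_power_series n))"
    and "\<And>i. i \<in> {1..n} \<Longrightarrow>
           magnus M n x (x i) = \<one>\<^bsub>nc_power_series n\<^esub> \<oplus>\<^bsub>nc_power_series n\<^esub> nc_var i"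
proof -
  interpret ring "nc_power_series n" by (rule ring_nc_power_series)
  have "(\<lambda>i. \<one>\<^bsub>nc_power_series n\<^esub> \<oplus>\<^bsub>nc_power_series n\<^esub> nc_var i)
      \<in> {1..n} \<rightarrow> carrier (units_of (nc_power_series n))"
    using one_plus_nc_var_unit by (auto simp: units_of_carrier)
  note lift = free_basis_lift[OF assms units_group this]
  show "magnus M n x \<in> hom M (units_of (nc_power_series n))"
    using lift(1) unfolding magnus_def .
  show "\<And>i. i \<in> {1..n} \<Longrightarrow>
           magnus M n x (x i) = \<one>\<^bsub>nc_power_series n\<^esub> \<oplus>\<^bsub>nc_power_series n\<^esub> nc_var i"
    using lift(2) unfolding magnus_def .
qed

text \<open>
  The relation \<open>lenlex less_than\<close> compares monomials first by degree and then lexicographically,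
  with \<open>X\<^sub>1 < X\<^sub>2 < \<cdots>\<close>.
\<close>

definition smallest_monomial :: "(nat list \<Rightarrow> int) \<Rightarrow> nat list \<Rightarrow> bool" where
  "smallest_monomial f m \<longleftrightarrow>
     f m \<noteq> 0 \<and> (\<forall>m'. f m' \<noteq> 0 \<longrightarrow> m' = m \<or> (m, m') \<in> lenlex less_than)"

definition magnus_cone :: "('a, 'b) monoid_scheme \<Rightarrow> nat \<Rightarrow> (nat \<Rightarrow> 'a) \<Rightarrow> 'a set" where
  "magnus_cone M n x =
     {a \<in> carrier M. a \<noteq> \<one>\<^bsub>M\<^esub> \<and>
        (let f = magnus M n x a \<ominus>\<^bsub>nc_power_series n\<^esub> \<one>\<^bsub>nc_power_series n\<^esub>
         in \<exists>m. smallest_monomial f m \<and> f m > 0)}"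

definition cone_less :: "('a, 'b) monoid_scheme \<Rightarrow> 'a set \<Rightarrow> 'a \<Rightarrow> 'a \<Rightarrow> bool" where
  "cone_less M P a b \<longleftrightarrow> inv\<^bsub>M\<^esub> a \<otimes>\<^bsub>M\<^esub> b \<in> P"


section \<open>Almost-direct products of free groups\<close>

definition is_semidirect :: "('a, 'b) monoid_scheme \<Rightarrow> 'a set \<Rightarrow> 'a set \<Rightarrow> bool" where
  "is_semidirect M N H \<longleftrightarrow>
     group M \<and> N \<lhd> M \<and> subgroup H M \<and> N \<inter> H = {\<one>\<^bsub>M\<^esub>} \<and> N <#>\<^bsub>M\<^esub> H = carrier M"

primrec stage :: "('a, 'b) monoid_scheme \<Rightarrow> (nat \<Rightarrow> 'a set) \<Rightarrow> nat \<Rightarrow> 'a set" where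
  "stage G F 0 = {\<one>\<^bsub>G\<^esub>}"
| "stage G F (Suc i) = F (Suc i) <#>\<^bsub>G\<^esub> stage G F i"

definition trivial_on_abelianization ::
    "('a, 'b) monoid_scheme \<Rightarrow> 'a set \<Rightarrow> 'a set \<Rightarrow> bool" where
  "trivial_on_abelianization G N H \<longleftrightarrow>
     (\<forall>h\<in>H. \<forall>a\<in>N.
        derived G N #>\<^bsub>G\<^esub> (h \<otimes>\<^bsub>G\<^esub> a \<otimes>\<^bsub>G\<^esub> inv\<^bsub>G\<^esub> h) = derived G N #>\<^bsub>G\<^esub> a)"

text \<open>
  The iterated semidirect product is internal: \<open>stage G F i\<close> is the subgroup
  \<open>G\<^sub>i = F\<^sub>i \<cdots> F\<^sub>1\<close> of \<open>G\<close>, and it acts on \<open>F\<^bsub>i+1\<^esub>\<close> by conjugation.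
\<close>

definition almost_direct_product ::
    "('a, 'b) monoid_scheme \<Rightarrow> nat \<Rightarrow> (nat \<Rightarrow> nat) \<Rightarrow> (nat \<Rightarrow> 'a set) \<Rightarrow> bool" where
  "almost_direct_product G k n F \<longleftrightarrow>
     group G \<and> k \<ge> 1 \<and> carrier G = stage G F k \<and>
     (\<forall>i\<in>{1..k}. subgroup (F i) G \<and> (\<exists>x. free_basis (G\<lparr>carrier := F i\<rparr>) (n i) x)) \<and>
     (\<forall>i\<in>{2..k}. subgroup (stage G F i) G \<and>
        is_semidirect (G\<lparr>carrier := stage G F i\<rparr>) (F i) (stage G F (i - 1)) \<and>
        trivial_on_abelianization G (F i) (stage G F (i - 1)))"

primrec descending_prod :: "('a, 'b) monoid_scheme \<Rightarrow> (nat \<Rightarrow> 'a) \<Rightarrow> nat \<Rightarrow> 'a" where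
  "descending_prod G c 0 = \<one>\<^bsub>G\<^esub>"
| "descending_prod G c (Suc i) = c (Suc i) \<otimes>\<^bsub>G\<^esub> descending_prod G c i"

definition normal_form ::
    "('a, 'b) monoid_scheme \<Rightarrow> nat \<Rightarrow> (nat \<Rightarrow> 'a set) \<Rightarrow> 'a \<Rightarrow> (nat \<Rightarrow> 'a) \<Rightarrow> bool" where
  "normal_form G k F g c \<longleftrightarrow> (\<forall>i\<in>{1..k}. c i \<in> F i) \<and> g = descending_prod G c k"

definition factor_map ::
    "('a, 'b) monoid_scheme \<Rightarrow> nat \<Rightarrow> (nat \<Rightarrow> 'a set) \<Rightarrow> nat \<Rightarrow> 'a \<Rightarrow> 'a" where
  "factor_map G k F j g = (THE a. \<exists>c. normal_form G k F g c \<and> a = c j)"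

definition lex_cone ::
    "('a, 'b) monoid_scheme \<Rightarrow> nat \<Rightarrow> (nat \<Rightarrow> 'a set) \<Rightarrow> (nat \<Rightarrow> 'a set) \<Rightarrow> 'a set" where
  "lex_cone G k F Pos =
     {g \<in> carrier G. \<exists>c. normal_form G k F g c \<and>
        (\<exists>j\<in>{1..k}. c j \<in> Pos j \<and> (\<forall>i\<in>{j<..k}. c i = \<one>\<^bsub>G\<^esub>))}"

end

theory Submission
  imports Defs
begin

text \<open>
  Each \<open>F\<^bsub>i+1\<^esub>\<close> meets \<open>G\<^sub>i\<close> trivially, so normal forms are unique. Hence the normal form that
  witnesses membership in the lexicographic cone is the given one; and since \<open>1\<close> lies in no Magnus
  cone, the index of the witness is the largest index with a nontrivial factor.
\<close>

text \<open>Rearranging \<open>eq\<close> gives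
  \<open>inv h' \<otimes> h = k' \<otimes> inv k\<close>, an element of both subgroups and hence
  trivial.\<close>

lemma (in group) subgroup_mult_inj:
  assumes H: "subgroup H G" and K: "subgroup K G" and trivial: "H \<inter> K = {\<one>}"
    and h: "h \<in> H" "h' \<in> H" and k: "k \<in> K" "k' \<in> K" and eq: "h \<otimes> k = h' \<otimes> k'"
  shows "h = h' \<and> k = k'"
proof -
  have c: "h \<in> carrier G" "h' \<in> carrier G" "k \<in> carrier G" "k' \<in> carrier G"
    using subgroup.mem_carrier[OF H] subgroup.mem_carrier[OF K] h k by auto
  have "inv h' \<otimes> h = inv h' \<otimes> (h \<otimes> k) \<otimes> inv k"
    using c by (simp add: m_assoc)
  also have "\<dots> = k' \<otimes> inv k"
    unfolding eq using c by (simp add: m_assoc[symmetric])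
  finally have *: "inv h' \<otimes> h = k' \<otimes> inv k" .
  have "inv h' \<otimes> h \<in> H" "k' \<otimes> inv k \<in> K"
    using H K h k by (auto intro: subgroup.m_closed subgroup.m_inv_closed)
  then have "inv h' \<otimes> h = \<one>" using trivial * by auto
  then have "h = h'" using c inv_solve_left[of \<one> h' h] by simp
  then show ?thesis using eq c by simp
qed

lemma descending_prod_in_stage:
  assumes "\<And>i. i \<in> {1..m} \<Longrightarrow> c i \<in> F i"
  shows "descending_prod G c m \<in> stage G F m"
  using assms by (induction m) (auto simp: set_mult_def)

text \<open>Induction on \<open>m\<close> peels off the top factor: \<open>subgroup_mult_inj\<close>
  separates \<open>F (Suc m)\<close> from \<open>stage G F m\<close>. The hypotheses are bounded by
  \<open>m\<close>, so they pass to the shorter product.\<close>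

lemma (in group) descending_prod_inj:
  assumes "\<And>i. i < m \<Longrightarrow> subgroup (F (Suc i)) G"
    and "\<And>i. i < m \<Longrightarrow> subgroup (stage G F i) G"
    and "\<And>i. i < m \<Longrightarrow> F (Suc i) \<inter> stage G F i = {\<one>}"
    and "\<And>i. i \<in> {1..m} \<Longrightarrow> c i \<in> F i" and "\<And>i. i \<in> {1..m} \<Longrightarrow> d i \<in> F i"
    and "descending_prod G c m = descending_prod G d m" and "i \<in> {1..m}"
  shows "c i = d i"
  using assms
proof (induction m)
  case (Suc m)
  have "c (Suc m) = d (Suc m) \<and> descending_prod G c m = descending_prod G d m"
    using Suc.prems
    by (intro subgroup_mult_inj[of "F (Suc m)" "stage G F m"] descending_prod_in_stage) auto
  then show ?case
    using Suc by (cases "i = Suc m") auto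
qed simp

lemma (in group) descending_prod_single:
  assumes "a \<in> carrier G"
  shows "descending_prod G (\<lambda>i. if i = j then a else \<one>) m = (if j \<in> {1..m} then a else \<one>)"
  using assms by (induction m) auto

text \<open>For positive \<open>i\<close> both facts come from the semidirect decomposition of
  \<open>stage G F (Suc i)\<close>, whose complement is \<open>stage G F i\<close>. The
  decompositions start at index 2, so \<open>i = 0\<close> is treated apart: there the stage is the
  trivial group.\<close>

lemma almost_direct_product_stage:
  fixes G (structure)
  assumes adp: "almost_direct_product G k n F" and i: "i < k"
  shows "subgroup (stage G F i) G" and "F (Suc i) \<inter> stage G F i = {\<one>}"
proof -
  interpret group G using adp by (simp add: almost_direct_product_def)
  have F: "subgroup (F (Suc i)) G" using adp i by (auto simp: almost_direct_product_def)
  have "subgroup (stage G F i) G \<and> F (Suc i) \<inter> stage G F i = {\<one>}"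
  proof (cases "i = 0")
    case True
    then show ?thesis using F triv_subgroup subgroup.one_closed by auto
  next
    case False
    \<comment> \<open>Reading the condition at \<open>Suc i\<close> instead of \<open>i\<close> also
      covers \<open>i = 1\<close>, where the definition does not directly say that the stage is a
      subgroup.\<close>
    then have "Suc i \<in> {2..k}" using i by auto
    moreover have "\<forall>i\<in>{2..k}. subgroup (stage G F i) G \<and>
        is_semidirect (G\<lparr>carrier := stage G F i\<rparr>) (F i) (stage G F (i - 1))"
      using adp by (simp add: almost_direct_product_def)
    ultimately have "subgroup (stage G F (Suc i)) G"
      "is_semidirect (G\<lparr>carrier := stage G F (Suc i)\<rparr>) (F (Suc i)) (stage G F i)"
      by (metis diff_Suc_1)+
    then show ?thesis using incl_subgroup unfolding is_semidirect_def by auto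
  qed
  then show "subgroup (stage G F i) G" "F (Suc i) \<inter> stage G F i = {\<one>}" by auto
qed

text \<open>\<open>normal_form\<close> leaves \<open>c\<close> free outside \<open>{1..k}\<close>,
  so agreement can be claimed only on that range.\<close>

lemma normal_form_unique:
  assumes adp: "almost_direct_product G k n F"
    and "normal_form G k F g c" "normal_form G k F g d" "i \<in> {1..k}"
  shows "c i = d i"
proof -
  interpret group G using adp by (simp add: almost_direct_product_def)
  show ?thesis
  proof (rule descending_prod_inj[of k F c d])
    show "subgroup (F (Suc m)) G" if "m < k" for m
      using adp that by (auto simp: almost_direct_product_def)
  qed (use assms almost_direct_product_stage[OF adp] in \<open>auto simp: normal_form_def\<close>)
qed

text \<open>Uniqueness of normal forms is what makes the definite description in
  \<open>factor_map\<close> denote.\<close>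

lemma factor_map_normal_form:
  assumes "almost_direct_product G k n F" "normal_form G k F g c" "j \<in> {1..k}"
  shows "factor_map G k F j g = c j"
  unfolding factor_map_def
  using assms(2) normal_form_unique[OF assms(1) _ assms(2,3)] by (intro the_equality) blast+

text \<open>This explicit normal form allows the lexicographic cone to be tested on a single free
  factor.\<close>

lemma normal_form_single:
  fixes G (structure)
  assumes adp: "almost_direct_product G k n F" and j: "j \<in> {1..k}" and a: "a \<in> F j"
  shows "normal_form G k F a (\<lambda>i. if i = j then a else \<one>)"
proof -
  interpret group G using adp by (simp add: almost_direct_product_def)
  have F: "subgroup (F i) G" if "i \<in> {1..k}" for i
    using adp that by (simp add: almost_direct_product_def)
  show ?thesis
    using F j a subgroup.mem_carrier[OF F[OF j] a]
    by (auto simp: normal_form_def descending_prod_single intro: subgroup.one_closed)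
qed

lemma lex_cone_leading_factor:
  fixes G (structure)
  assumes adp: "almost_direct_product G k n F" and one: "\<And>i. i \<in> {1..k} \<Longrightarrow> \<one> \<notin> Pos i"
    and c: "normal_form G k F g c" and g: "g \<in> lex_cone G k F Pos"
  defines "j \<equiv> Max {i \<in> {1..k}. c i \<noteq> \<one>}"
  shows "j \<in> {1..k}" and "c j \<in> Pos j"
proof -
  obtain d m where d: "normal_form G k F g d" "m \<in> {1..k}" "d m \<in> Pos m"
    "\<forall>i\<in>{m<..k}. d i = \<one>"
    using g by (auto simp: lex_cone_def)
  have cd: "c i = d i" if "i \<in> {1..k}" for i using normal_form_unique[OF adp c d(1) that] .
  have "j = m"
    unfolding j_def
  proof (rule Max_eqI)
    show "i \<le> m" if "i \<in> {i \<in> {1..k}. c i \<noteq> \<one>}" for i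
      using that cd[of i] d(4) by (cases "i \<le> m") auto
  \<comment> \<open>The witness \<open>m\<close> lies in the set because \<open>d m\<close> is in
    \<open>Pos m\<close>, which omits \<open>\<one>\<close>; so \<open>Max\<close> is taken over a
    nonempty set.\<close>
  qed (use d one cd in auto)
  then show "j \<in> {1..k}" "c j \<in> Pos j" using d cd by auto
qed

text \<open>The normal form of \<open>a\<close> can be nontrivial only at position \<open>j\<close>,
  so only \<open>Pos j\<close> can decide membership in the cone.\<close>

lemma lex_cone_inter_factor:
  fixes G (structure)
  assumes adp: "almost_direct_product G k n F" and one: "\<And>i. i \<in> {1..k} \<Longrightarrow> \<one> \<notin> Pos i"
    and j: "j \<in> {1..k}" and a: "a \<in> F j"
  shows "a \<in> lex_cone G k F Pos \<longleftrightarrow> a \<in> Pos j"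
proof
  let ?c = "\<lambda>i. if i = j then a else \<one>"
  have c: "normal_form G k F a ?c" using normal_form_single[OF adp j a] .
  {
    assume "a \<in> lex_cone G k F Pos"
    then obtain m where "m \<in> {1..k}" "?c m \<in> Pos m"
      using lex_cone_leading_factor[where Pos = Pos, OF adp one c] by blast
    \<comment> \<open>If \<open>m\<close> differed from \<open>j\<close>, then \<open>?c m\<close>
      would be \<open>\<one>\<close>, which is not in \<open>Pos m\<close>.\<close>
    then show "a \<in> Pos j" using one by (cases "m = j") auto
  next
    assume "a \<in> Pos j"
    moreover have "a \<in> carrier G"
      using adp j a subgroup.mem_carrier[of "F j" G a] by (simp add: almost_direct_product_def)
    ultimately show "a \<in> lex_cone G k F Pos"
      using c j by (auto simp: lex_cone_def intro!: exI[of _ ?c] bexI[of _ j])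
  }
qed

theorem proposition6:
  fixes G :: "('a, 'b) monoid_scheme" (structure)
    and k :: nat
    and n :: "nat \<Rightarrow> nat"
    and F :: "nat \<Rightarrow> 'a set"
    and x :: "nat \<Rightarrow> nat \<Rightarrow> 'a"
    and Pos :: "nat \<Rightarrow> 'a set"
    and P :: "'a set"
  assumes "almost_direct_product G k n F"
    and "\<And>i. i \<in> {1..k} \<Longrightarrow> free_basis (G\<lparr>carrier := F i\<rparr>) (n i) (x i)"
    and "\<And>i. i \<in> {1..k} \<Longrightarrow> Pos i = magnus_cone (G\<lparr>carrier := F i\<rparr>) (n i) (x i)"
    and "P = lex_cone G k F Pos"
  shows "(\<forall>g\<in>carrier G. \<forall>c j.
            normal_form G k F g c \<longrightarrow> g \<in> P \<longrightarrow> j = Max {i \<in> {1..k}. c i \<noteq> \<one>} \<longrightarrow>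
              factor_map G k F j g = c j \<and> c j \<in> Pos j) \<and>
         (\<forall>j\<in>{1..k}. \<forall>a\<in>F j. \<forall>b\<in>F j.
            cone_less G P a b \<longleftrightarrow> cone_less (G\<lparr>carrier := F j\<rparr>) (Pos j) a b)"
proof (intro conjI allI ballI impI)
  have one: "\<one> \<notin> Pos i" if "i \<in> {1..k}" for i
    using assms(3)[OF that] by (simp add: magnus_cone_def)
  fix g c j assume "normal_form G k F g c" "g \<in> P" "j = Max {i \<in> {1..k}. c i \<noteq> \<one>}"
  then show "factor_map G k F j g = c j" "c j \<in> Pos j"
    using lex_cone_leading_factor[OF assms(1) one] factor_map_normal_form[OF assms(1)] assms(4)
    by simp_all
next
  interpret group G using assms(1) by (simp add: almost_direct_product_def)
  fix j a b assume j: "j \<in> {1..k}" and ab: "a \<in> F j" "b \<in> F j"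
  have F: "subgroup (F j) G" using assms(1) j by (simp add: almost_direct_product_def)
  \<comment> \<open>Both orderings are tested on this one element, so comparing them on
    \<open>F j\<close> reduces to comparing their cones there.\<close>
  have "inv a \<otimes> b \<in> F j" using F ab by (intro subgroup.m_closed subgroup.m_inv_closed)
  moreover have "\<one> \<notin> Pos i" if "i \<in> {1..k}" for i
    using assms(3)[OF that] by (simp add: magnus_cone_def)
  ultimately have "inv a \<otimes> b \<in> P \<longleftrightarrow> inv a \<otimes> b \<in> Pos j"
    using lex_cone_inter_factor[OF assms(1) _ j] assms(4) by blast
  \<comment> \<open>The inverse in the right-hand \<open>cone_less\<close> is taken in the subgroup;
    \<open>m_inv_consistent\<close> identifies it with the inverse in \<open>G\<close>.\<close>
  then show "cone_less G P a b \<longleftrightarrow> cone_less (G\<lparr>carrier := F j\<rparr>) (Pos j) a b"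
    using m_inv_consistent[OF F ab(1)] by (simp add: cone_less_def)
qed

end
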